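(* Let $\sigma_1>0$, $\sigma_2>0$, $\alpha>0$, $0\leqslant\rho\leqslant1$, and let $(X_1,X_2)^\top$ be a random vector following the bivariate extreme distribution with Fréchet margins with parameters $\sigma_1,\sigma_2,\alpha,\rho$. Put $\sigma=\sigma_1/\sigma_2$ and $\boldsymbol{\theta}=(\sigma,\alpha,\rho)^\top$. Then, for all $0<w<1$, with $s=w/(1-w)$, $$\mathbb{P}\left(\frac{X_1}{X_1+X_2}\leqslant w\right)=\frac{\frac{s^\alpha}{\sigma^\alpha}}{\frac{s^\alpha}{\sigma^\alpha}+1}\cdot\frac{\left(\frac{s^\alpha}{\sigma^\alpha}+1\right)^2-\rho}{\left(\frac{s^\alpha}{\sigma^\alpha}+1\right)^2-\rho\,\frac{s^\alpha}{\sigma^\alpha}}=F_W(w;\boldsymbol{\theta}).$$ That is, if $W\sim{\rm UF}(\boldsymbol{\theta})$, then $W$ is equal in distribution to $X_1/(X_1+X_2)$.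
   Context: A random vector $(X_1,X_2)^\top$ with nonnegative components follows the bivariate extreme distribution with Fréchet margins with parameters $\sigma_1,\sigma_2,\alpha>0$ and $0\leqslant\rho\leqslant1$ if its joint CDF is $$F_{X_1,X_2}(x_1,x_2)=\exp\left\{-\left(\frac{x_1}{\sigma_1}\right)^{-\alpha}-\left(\frac{x_2}{\sigma_2}\right)^{-\alpha}+\rho\left[\left(\frac{x_1}{\sigma_1}\right)^\alpha+\left(\frac{x_2}{\sigma_2}\right)^\alpha\right]^{-1}\right\}$$ for $x_1,x_2>0$ (and $0$ if $x_1\leqslant0$ or $x_2\leqslant0$). For $\boldsymbol{\theta}=(\sigma,\alpha,\rho)^\top$ with $\sigma>0$, $\alpha>0$, $0\leqslant\rho\leqslant1$, the unit-Fréchet distribution ${\rm UF}(\boldsymbol{\theta})$ is the distribution on $(0,1)$ with CDF, for $0<w<1$, $$F_W(w;\boldsymbol{\theta})=\frac{\frac{s^\alpha}{\sigma^\alpha}}{\frac{s^\alpha}{\sigma^\alpha}+1}\cdot\frac{\left(\frac{s^\alpha}{\sigma^\alpha}+1\right)^2-\rho}{\left(\frac{s^\alpha}{\sigma^\alpha}+1\right)^2-\rho\,\frac{s^\alpha}{\sigma^\alpha}},\qquad s=\frac{w}{1-w}.$$ *)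

theory Defs
  imports "HOL-Probability.Probability"
begin

definition bivariate_frechet_cdf ::
    "real \<Rightarrow> real \<Rightarrow> real \<Rightarrow> real \<Rightarrow> real \<Rightarrow> real \<Rightarrow> real" where
  "bivariate_frechet_cdf \<sigma>1 \<sigma>2 \<alpha> \<rho> x1 x2 =
     (if x1 \<le> 0 \<or> x2 \<le> 0 then 0
      else exp (- ((x1 / \<sigma>1) powr (- \<alpha>)) - (x2 / \<sigma>2) powr (- \<alpha>)
                + \<rho> * inverse ((x1 / \<sigma>1) powr \<alpha> + (x2 / \<sigma>2) powr \<alpha>)))"

definition bivariate_extreme_frechet ::
    "'a measure \<Rightarrow> ('a \<Rightarrow> real) \<Rightarrow> ('a \<Rightarrow> real) \<Rightarrow> real \<Rightarrow> real \<Rightarrow> real \<Rightarrow> real \<Rightarrow> bool" where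
  "bivariate_extreme_frechet M X1 X2 \<sigma>1 \<sigma>2 \<alpha> \<rho> \<longleftrightarrow>
     prob_space M \<and> X1 \<in> borel_measurable M \<and> X2 \<in> borel_measurable M \<and>
     (AE \<omega> in M. 0 \<le> X1 \<omega> \<and> 0 \<le> X2 \<omega>) \<and>
     (\<forall>x1 x2. measure M {\<omega> \<in> space M. X1 \<omega> \<le> x1 \<and> X2 \<omega> \<le> x2}
              = bivariate_frechet_cdf \<sigma>1 \<sigma>2 \<alpha> \<rho> x1 x2)"

(* Only meaningful for 0 < w < 1. *)
definition unit_frechet_cdf :: "real \<Rightarrow> real \<Rightarrow> real \<Rightarrow> real \<Rightarrow> real" where
  "unit_frechet_cdf \<sigma> \<alpha> \<rho> w =
     (let s = w / (1 - w); t = s powr \<alpha> / \<sigma> powr \<alpha>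
      in t / (t + 1) * (((t + 1)\<^sup>2 - \<rho>) / ((t + 1)\<^sup>2 - \<rho> * t)))"

definition unit_frechet ::
    "'a measure \<Rightarrow> ('a \<Rightarrow> real) \<Rightarrow> real \<Rightarrow> real \<Rightarrow> real \<Rightarrow> bool" where
  "unit_frechet N W \<sigma> \<alpha> \<rho> \<longleftrightarrow>
     prob_space N \<and> W \<in> borel_measurable N \<and>
     (AE \<omega> in N. 0 < W \<omega> \<and> W \<omega> < 1) \<and>
     (\<forall>w. 0 < w \<and> w < 1 \<longrightarrow> cdf (distr N borel W) w = unit_frechet_cdf \<sigma> \<alpha> \<rho> w)"

end

theory Submission
  imports Defs "HOL-Real_Asymp.Real_Asymp"
begin

text \<open>Normalise to \<open>U = (X1 / \<sigma>1)\<^sup>\<alpha>\<close> and \<open>V = (X2 / \<sigma>2)\<^sup>\<alpha>\<close>, whose joint CDF \<open>F\<close> is the case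
  \<open>\<sigma>1 = \<sigma>2 = \<alpha> = 1\<close>. The event is then \<open>U \<le> t V\<close> with \<open>t = (s / \<sigma>)\<^sup>\<alpha>\<close>, and its probability is
  the integral of \<open>\<partial>\<^sub>v F (t v, v)\<close> over \<open>v > 0\<close>. No joint density is needed: rounding \<open>V\<close> up to a
  multiple of \<open>1 / n\<close> on the right-hand side turns the event into a union of strips, each
  computed by the fundamental theorem of calculus, and both sides pass to the limit by dominated
  convergence. Since \<open>- ln F\<close> is homogeneous of degree \<open>-1\<close>, the integrand is a multiple of
  \<open>exp (- c / v) / v\<^sup>2\<close>, where \<open>F (t v, v) = exp (- c / v)\<close>.\<close>

section \<open>The fundamental theorem of calculus for nonnegative integrands\<close>

lemma LBINT_FTC_nonneg_Ioi:
  fixes f F :: "real \<Rightarrow> real"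
  assumes F: "\<And>x. 0 < x \<Longrightarrow> (F has_real_derivative f x) (at x)"
    and f: "\<And>x. 0 < x \<Longrightarrow> isCont f x" "\<And>x. 0 < x \<Longrightarrow> 0 \<le> f x"
    and A: "(F \<longlongrightarrow> A) (at_right 0)" and B: "(F \<longlongrightarrow> B) at_top"
  shows "set_integrable lborel {0<..} f" "(LBINT x:{0<..}. f x) = B - A"
proof -
  have A': "((F \<circ> real_of_ereal) \<longlongrightarrow> A) (at_right 0)"
    using A by (simp add: zero_ereal_def ereal_tendsto_simps)
  have B': "((F \<circ> real_of_ereal) \<longlongrightarrow> B) (at_left \<infinity>)"
    using B by (simp add: ereal_tendsto_simps)
  have ei: "einterval 0 \<infinity> = {0<..}"
    by (simp add: zero_ereal_def)
  have *: "set_integrable lborel (einterval 0 \<infinity>) f" "(LBINT x=0..\<infinity>. f x) = B - A"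
    by (rule interval_integral_FTC_nonneg[OF _ _ _ _ A' B']; use F f in \<open>auto simp: zero_ereal_def\<close>)+
  then show "set_integrable lborel {0<..} f" "(LBINT x:{0<..}. f x) = B - A"
    by (auto simp: ei interval_lebesgue_integral_def zero_ereal_def)
qed

text \<open>The left end enters through the limit \<open>A\<close> instead of \<open>F a\<close>,
  since the formula it is applied to has a division by zero at \<open>a = 0\<close>. The nonnegative
  integral lets the results be summed as values of a measure.\<close>

lemma nn_integral_FTC_Ioc:
  fixes f F :: "real \<Rightarrow> real" and a b :: real
  assumes "a < b"
    and F: "\<And>x. a < x \<Longrightarrow> (F has_real_derivative f x) (at x)"
    and f: "\<And>x. a < x \<Longrightarrow> isCont f x" "\<And>x. a < x \<Longrightarrow> 0 \<le> f x"
    and A: "(F \<longlongrightarrow> A) (at_right a)"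
  shows "(\<integral>\<^sup>+x\<in>{a<..b}. ennreal (f x) \<partial>lborel) = ennreal (F b - A)"
proof -
  have A': "((F \<circ> real_of_ereal) \<longlongrightarrow> A) (at_right (ereal a))"
    using A by (simp add: ereal_tendsto_simps)
  \<comment> \<open>Differentiability holds on all of \<open>x > a\<close>, so \<open>F\<close> is
    continuous at \<open>b\<close> itself.\<close>
  have "(F \<longlongrightarrow> F b) (at_left b)"
    using F[OF \<open>a < b\<close>] DERIV_isCont filterlim_at_split isCont_def by blast
  then have B': "((F \<circ> real_of_ereal) \<longlongrightarrow> F b) (at_left (ereal b))"
    by (simp add: ereal_tendsto_simps)
  have *: "set_integrable lborel (einterval a b) f" "(LBINT x=a..b. f x) = F b - A"
    by (rule interval_integral_FTC_nonneg[OF _ _ _ _ A' B']; use F f \<open>a < b\<close> in auto)+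
  have "(\<integral>\<^sup>+x\<in>{a<..b}. ennreal (f x) \<partial>lborel)
      = (\<integral>\<^sup>+x. ennreal (indicator {a<..<b} x * f x) \<partial>lborel)"
    using AE_lborel_singleton[of b]
    by (intro nn_integral_cong_AE, eventually_elim) (auto simp: indicator_def)
  also have "\<dots> = ennreal (\<integral>x. indicator {a<..<b} x * f x \<partial>lborel)"
    using *(1) f by (intro nn_integral_eq_integral) (auto simp: set_integrable_def indicator_def)
  also have "(\<integral>x. indicator {a<..<b} x * f x \<partial>lborel) = F b - A"
    using *(2) \<open>a < b\<close> by (simp add: interval_lebesgue_integral_def set_lebesgue_integral_def)
  finally show ?thesis .
qed

text \<open>\<open>exp (- c / v) / c\<close> is an antiderivative that rises from 0 at the origin to
  \<open>1 / c\<close> at infinity. The case \<open>c = 1\<close> also provides the majorant for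
  dominated convergence.\<close>

lemma LBINT_exp_neg_inverse:
  fixes c :: real
  assumes "c > 0"
  shows "set_integrable lborel {0<..} (\<lambda>v. exp (- c / v) / v\<^sup>2)"
    and "(LBINT v:{0<..}. exp (- c / v) / v\<^sup>2) = 1 / c"
proof -
  have d: "((\<lambda>v. exp (- c / v) / c) has_real_derivative exp (- c / x) / x\<^sup>2) (at x)"
    if "0 < x" for x
    using that assms by (auto intro!: derivative_eq_intros simp: field_simps power2_eq_square)
  have A: "((\<lambda>v. exp (- c / v) / c) \<longlongrightarrow> 0) (at_right 0)"
    using assms by real_asymp
  have B: "((\<lambda>v. exp (- c / v) / c) \<longlongrightarrow> inverse c) at_top"
    using assms by real_asymp
  show "set_integrable lborel {0<..} (\<lambda>v. exp (- c / v) / v\<^sup>2)"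
    by (rule LBINT_FTC_nonneg_Ioi(1)[OF d _ _ A B]) auto
  show "(LBINT v:{0<..}. exp (- c / v) / v\<^sup>2) = 1 / c"
    using LBINT_FTC_nonneg_Ioi(2)[OF d _ _ A B] by (auto simp: inverse_eq_divide)
qed

section \<open>The standardised distribution function and its partial derivative\<close>

text \<open>This is the joint CDF only for positive \<open>u\<close> and \<open>v\<close>: on the
  axes, division by zero yields a positive value instead of 0.\<close>

definition std_frechet_cdf :: "real \<Rightarrow> real \<Rightarrow> real \<Rightarrow> real" where
  "std_frechet_cdf \<rho> u v = exp (- 1 / u - 1 / v + \<rho> / (u + v))"

text \<open>The partial derivative in \<open>v\<close>, that is, the density of \<open>V\<close>
  restricted to the event \<open>U \<le> u\<close>.\<close>

definition std_frechet_dcdf :: "real \<Rightarrow> real \<Rightarrow> real \<Rightarrow> real" where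
  "std_frechet_dcdf \<rho> u v = std_frechet_cdf \<rho> u v * (1 / v\<^sup>2 - \<rho> / (u + v)\<^sup>2)"

lemma std_frechet_cdf_has_derivative:
  assumes "0 < u" "0 < v"
  shows "(std_frechet_cdf \<rho> u has_real_derivative std_frechet_dcdf \<rho> u v) (at v)"
proof -
  have "((\<lambda>v. - 1 / u - 1 / v + \<rho> / (u + v)) has_real_derivative
      1 / v\<^sup>2 - \<rho> / (u + v)\<^sup>2) (at v)"
    using assms by (auto intro!: derivative_eq_intros simp: power2_eq_square)
  from DERIV_fun_exp[OF this] show ?thesis
    by (simp add: std_frechet_cdf_def[abs_def] std_frechet_dcdf_def)
qed

lemma std_frechet_dcdf_nonneg:
  assumes "\<rho> \<le> 1" "0 < u" "0 < v"
  shows "0 \<le> std_frechet_dcdf \<rho> u v"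
proof -
  have "\<rho> / (u + v)\<^sup>2 \<le> 1 / v\<^sup>2"
    using assms by (intro frac_le power_mono) auto
  then show ?thesis
    by (simp add: std_frechet_dcdf_def std_frechet_cdf_def)
qed

text \<open>The term \<open>- 1 / u\<close> outweighs \<open>\<rho> / (u + v)\<close>. The bound is
  the CDF of the second margin and does not depend on \<open>u\<close>.\<close>

lemma std_frechet_cdf_le:
  assumes "\<rho> \<le> 1" "0 < u" "0 < v"
  shows "std_frechet_cdf \<rho> u v \<le> exp (- 1 / v)"
proof -
  have "\<rho> / (u + v) \<le> 1 / u"
    using assms by (intro frac_le) auto
  then show ?thesis
    by (simp add: std_frechet_cdf_def)
qed

text \<open>As the bound does not depend on \<open>u\<close>, it dominates the integrands of all
  grids at once.\<close>

lemma std_frechet_dcdf_le: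
  assumes "0 \<le> \<rho>" "\<rho> \<le> 1" "0 < u" "0 < v"
  shows "std_frechet_dcdf \<rho> u v \<le> exp (- 1 / v) / v\<^sup>2"
proof -
  have "std_frechet_dcdf \<rho> u v \<le> std_frechet_cdf \<rho> u v * (1 / v\<^sup>2)"
    unfolding std_frechet_dcdf_def
    using assms by (intro mult_left_mono) (auto simp: std_frechet_cdf_def)
  also have "\<dots> \<le> exp (- 1 / v) * (1 / v\<^sup>2)"
    using assms by (intro mult_right_mono std_frechet_cdf_le) auto
  finally show ?thesis by simp
qed

text \<open>Continuity in \<open>v\<close> serves the fundamental theorem on a strip, continuity in
  \<open>u\<close> the limit of refining grids.\<close>

lemma isCont_std_frechet_dcdf:
  assumes "0 < u" "0 < v"
  shows "isCont (std_frechet_dcdf \<rho> u) v" "isCont (\<lambda>u. std_frechet_dcdf \<rho> u v) u"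
  unfolding std_frechet_dcdf_def[abs_def] std_frechet_cdf_def
  using assms by (auto intro!: continuous_intros)

lemma std_frechet_cdf_at_right_0:
  assumes "\<rho> \<le> 1" "0 < u"
  shows "(std_frechet_cdf \<rho> u \<longlongrightarrow> 0) (at_right 0)"
proof (rule tendsto_sandwich[OF _ _ tendsto_const])
  show "\<forall>\<^sub>F v in at_right 0. std_frechet_cdf \<rho> u v \<le> exp (- 1 / v)"
    using eventually_at_right_less by eventually_elim (rule std_frechet_cdf_le[OF assms])
  show "((\<lambda>v. exp (- 1 / v :: real)) \<longlongrightarrow> 0) (at_right 0)"
    by real_asymp
qed (simp add: std_frechet_cdf_def)

text \<open>On the ray \<open>u = t v\<close> the exponent scales as \<open>1 / v\<close> and the
  other factor as \<open>1 / v\<^sup>2\<close>, which leaves an integrand with an elementary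
  antiderivative.\<close>

lemma std_frechet_dcdf_ray:
  assumes "0 \<le> \<rho>" "\<rho> \<le> 1" "0 < t" "0 < v"
  shows "std_frechet_dcdf \<rho> (t * v) v
    = (1 - \<rho> / (t + 1)\<^sup>2) * (exp (- (1 / t + 1 - \<rho> / (t + 1)) / v) / v\<^sup>2)"
proof -
  have *: "t * v + v = (t + 1) * v" by (simp add: algebra_simps)
  have "- 1 / (t * v) - 1 / v + \<rho> / ((t + 1) * v) = - (1 / t + 1 - \<rho> / (t + 1)) / v"
    using assms by (simp add: divide_simps) (simp add: algebra_simps)
  moreover have "1 / v\<^sup>2 - \<rho> / ((t + 1) * v)\<^sup>2 = (1 - \<rho> / (t + 1)\<^sup>2) * (1 / v\<^sup>2)"
    using assms by (simp add: power_mult_distrib diff_divide_distrib)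
  ultimately show ?thesis
    unfolding std_frechet_dcdf_def std_frechet_cdf_def * by simp
qed

lemma LBINT_std_frechet_dcdf_ray:
  assumes "0 \<le> \<rho>" "\<rho> \<le> 1" "0 < t"
  shows "(LBINT v:{0<..}. std_frechet_dcdf \<rho> (t * v) v)
    = t / (t + 1) * (((t + 1)\<^sup>2 - \<rho>) / ((t + 1)\<^sup>2 - \<rho> * t))"
proof -
  define c where "c = 1 / t + 1 - \<rho> / (t + 1)"
  \<comment> \<open>Since \<open>\<rho> \<le> 1 < t + 1\<close>, the negative term of
    \<open>c\<close> is outweighed by its summand 1.\<close>
  have "\<rho> / (t + 1) < 1"
    using assms by (simp add: divide_simps)
  moreover have "0 < 1 / t"
    using assms by simp
  ultimately have c: "c > 0"
    unfolding c_def by linarith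
  have "(LBINT v:{0<..}. std_frechet_dcdf \<rho> (t * v) v)
      = (LBINT v:{0<..}. (1 - \<rho> / (t + 1)\<^sup>2) * (exp (- c / v) / v\<^sup>2))"
    using assms by (intro set_lebesgue_integral_cong) (auto simp: std_frechet_dcdf_ray c_def)
  also have "\<dots> = (1 - \<rho> / (t + 1)\<^sup>2) * (1 / c)"
    using LBINT_exp_neg_inverse(2)[OF c] by (simp only: set_integral_mult_right)
  also have "c = ((t + 1)\<^sup>2 - \<rho> * t) / (t * (t + 1))"
    unfolding c_def using assms
    by (simp add: divide_simps) (simp add: algebra_simps power2_eq_square)
  also have "(1 - \<rho> / (t + 1)\<^sup>2) * (1 / (((t + 1)\<^sup>2 - \<rho> * t) / (t * (t + 1))))
     = t / (t + 1) * (((t + 1)\<^sup>2 - \<rho>) / ((t + 1)\<^sup>2 - \<rho> * t))"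
  proof -
    have "1 - \<rho> / (t + 1)\<^sup>2 = ((t + 1)\<^sup>2 - \<rho>) / (t + 1)\<^sup>2"
      using assms by (simp add: diff_divide_distrib)
    then show ?thesis
      using assms by (simp add: power2_eq_square)
  qed
  finally show ?thesis .
qed

section \<open>Rounding up to a grid of mesh \<open>1 / (n + 1)\<close>\<close>

definition grid_ceiling :: "nat \<Rightarrow> real \<Rightarrow> real" where
  "grid_ceiling n v = of_int \<lceil>real (Suc n) * v\<rceil> / real (Suc n)"

lemma grid_ceiling_ge: "v \<le> grid_ceiling n v"
  by (simp add: grid_ceiling_def field_simps del: of_nat_Suc)

text \<open>The rounding error lies between 0 and \<open>1 / (n + 1)\<close>.\<close>

lemma grid_ceiling_tendsto: "(\<lambda>n. grid_ceiling n v) \<longlonglongrightarrow> v"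
proof (rule tendsto_sandwich[OF _ _ tendsto_const])
  show "\<forall>\<^sub>F n in sequentially. v \<le> grid_ceiling n v"
    by (simp add: grid_ceiling_ge)
  have "of_int \<lceil>real (Suc n) * v\<rceil> \<le> real (Suc n) * v + 1" for n
    by linarith
  then have "grid_ceiling n v \<le> (real (Suc n) * v + 1) / real (Suc n)" for n
    unfolding grid_ceiling_def by (intro divide_right_mono) auto
  then show "\<forall>\<^sub>F n in sequentially. grid_ceiling n v \<le> v + inverse (real (Suc n))"
    by (simp add: field_simps del: of_nat_Suc)
  show "(\<lambda>n. v + inverse (real (Suc n))) \<longlonglongrightarrow> v"
    by (rule LIMSEQ_inverse_real_of_nat_add)
qed

lemma borel_measurable_grid_ceiling [measurable]: "grid_ceiling n \<in> borel_measurable borel"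
  unfolding grid_ceiling_def[abs_def] by measurable

text \<open>Open on the left and closed on the right to match the ceiling; natural indices confine
  the cells to the positive axis.\<close>

definition grid_cell :: "nat \<Rightarrow> nat \<Rightarrow> real set" where
  "grid_cell n k = {real k / real (Suc n) <.. real (Suc k) / real (Suc n)}"

text \<open>Seen as fibres of the ceiling, the cells are readily disjoint and covering. The ceiling
  numbers right endpoints, hence the shift from \<open>k\<close> to \<open>Suc k\<close>.\<close>

lemma grid_cell_iff: "v \<in> grid_cell n k \<longleftrightarrow> \<lceil>real (Suc n) * v\<rceil> = int (Suc k)"
  unfolding grid_cell_def ceiling_eq_iff by (auto simp: field_simps simp del: of_nat_Suc)

lemma disjoint_family_grid_cell: "disjoint_family (grid_cell n)"
  by (auto simp: disjoint_family_on_def grid_cell_iff)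

lemma UN_grid_cell: "(\<Union>k. grid_cell n k) = {0<..}"
proof (intro equalityI subsetI)
  fix v assume "v \<in> (\<Union>k. grid_cell n k)"
  then show "v \<in> {0<..}"
    by (auto simp: grid_cell_def intro: le_less_trans[rotated])
next
  fix v :: real assume "v \<in> {0<..}"
  then have "\<lceil>real (Suc n) * v\<rceil> > 0"
    by (simp del: of_nat_Suc)
  then obtain k where "\<lceil>real (Suc n) * v\<rceil> = int (Suc k)"
    by (metis gr0_implies_Suc zero_less_imp_eq_int)
  then show "v \<in> (\<Union>k. grid_cell n k)"
    unfolding UN_iff grid_cell_iff by blast
qed

lemma grid_ceiling_cell: "v \<in> grid_cell n k \<Longrightarrow> grid_ceiling n v = real (Suc k) / real (Suc n)"
  unfolding grid_cell_iff grid_ceiling_def by simp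

section \<open>Probabilities of strips and of the region cut off by a ray\<close>

text \<open>The probability is a difference of two CDF values with \<open>u = a\<close> fixed, hence
  an integral of the partial derivative in \<open>v\<close>.\<close>

lemma (in prob_space) std_frechet_strip:
  assumes [measurable]: "random_variable borel U" "random_variable borel V"
    and V: "AE \<omega> in M. 0 < V \<omega>"
    and UV: "\<And>u v. 0 < u \<Longrightarrow> 0 < v \<Longrightarrow>
        prob {\<omega> \<in> space M. U \<omega> \<le> u \<and> V \<omega> \<le> v} = std_frechet_cdf \<rho> u v"
    and \<rho>: "\<rho> \<le> 1" and a: "0 < a" and bc: "0 \<le> b" "b < c"
  shows "emeasure M {\<omega> \<in> space M. U \<omega> \<le> a \<and> V \<omega> \<in> {b<..c}}
    = (\<integral>\<^sup>+v\<in>{b<..c}. ennreal (std_frechet_dcdf \<rho> a v) \<partial>lborel)"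
proof -
  \<comment> \<open>At \<open>b = 0\<close> the formula gives the nonzero value
    \<open>exp ((\<rho> - 1) / a)\<close>, so the true boundary value 0 is put in by hand.\<close>
  define A where "A = (if b = 0 then 0 else std_frechet_cdf \<rho> a b)"
  have A: "(std_frechet_cdf \<rho> a \<longlongrightarrow> A) (at_right b)"
  proof (cases "b = 0")
    case False
    with bc have "0 < b" by simp
    then have "isCont (std_frechet_cdf \<rho> a) b"
      by (intro DERIV_isCont[OF std_frechet_cdf_has_derivative] a)
    then show ?thesis
      using False unfolding isCont_def filterlim_at_split by (simp add: A_def)
  qed (use std_frechet_cdf_at_right_0[OF \<rho> a] in \<open>simp add: A_def\<close>)
  have Pb: "prob {\<omega> \<in> space M. U \<omega> \<le> a \<and> V \<omega> \<le> b} = A"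
  proof (cases "b = 0")
    case True
    \<comment> \<open>\<open>UV\<close> speaks of positive \<open>v\<close> only; at 0 the event is
      null because \<open>V\<close> is positive almost surely.\<close>
    have "prob {\<omega> \<in> space M. U \<omega> \<le> a \<and> V \<omega> \<le> 0} = prob {}"
      using V by (intro measure_eq_AE) (auto elim!: eventually_mono)
    then show ?thesis using True by (simp add: A_def)
  qed (use bc a UV in \<open>simp add: A_def\<close>)
  have "{\<omega> \<in> space M. U \<omega> \<le> a \<and> V \<omega> \<in> {b<..c}}
      = {\<omega> \<in> space M. U \<omega> \<le> a \<and> V \<omega> \<le> c} - {\<omega> \<in> space M. U \<omega> \<le> a \<and> V \<omega> \<le> b}"
    by auto
  also have "prob \<dots> = prob {\<omega> \<in> space M. U \<omega> \<le> a \<and> V \<omega> \<le> c}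
      - prob {\<omega> \<in> space M. U \<omega> \<le> a \<and> V \<omega> \<le> b}"
    using bc by (intro finite_measure_Diff) auto
  finally have "emeasure M {\<omega> \<in> space M. U \<omega> \<le> a \<and> V \<omega> \<in> {b<..c}}
      = ennreal (std_frechet_cdf \<rho> a c - A)"
    using UV[OF a, of c] bc Pb by (simp add: emeasure_eq_measure)
  also have "\<dots> = (\<integral>\<^sup>+v\<in>{b<..c}. ennreal (std_frechet_dcdf \<rho> a v) \<partial>lborel)"
    using bc a \<rho> by (intro nn_integral_FTC_Ioc[symmetric] A std_frechet_cdf_has_derivative
        isCont_std_frechet_dcdf std_frechet_dcdf_nonneg) auto
  finally show ?thesis .
qed

lemma borel_measurable_std_frechet_dcdf [measurable]:
  "case_prod (std_frechet_dcdf \<rho>) \<in> borel_measurable (borel \<Otimes>\<^sub>M borel)"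
  unfolding std_frechet_dcdf_def[abs_def] std_frechet_cdf_def by measurable

text \<open>On each cell the rounded \<open>V\<close> is constant, so the event splits into strips,
  and countable additivity recombines their integrals.\<close>

lemma (in prob_space) std_frechet_below_grid_ray:
  assumes [measurable]: "random_variable borel U" "random_variable borel V"
    and V: "AE \<omega> in M. 0 < V \<omega>"
    and UV: "\<And>u v. 0 < u \<Longrightarrow> 0 < v \<Longrightarrow>
        prob {\<omega> \<in> space M. U \<omega> \<le> u \<and> V \<omega> \<le> v} = std_frechet_cdf \<rho> u v"
    and \<rho>: "0 \<le> \<rho>" "\<rho> \<le> 1" and t: "0 < t"
  shows "prob {\<omega> \<in> space M. U \<omega> \<le> t * grid_ceiling n (V \<omega>)}
    = (LBINT v:{0<..}. std_frechet_dcdf \<rho> (t * grid_ceiling n v) v)"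
proof -
  define f where "f v = ennreal (std_frechet_dcdf \<rho> (t * grid_ceiling n v) v)" for v
  have [measurable]: "f \<in> borel_measurable borel"
    unfolding f_def by measurable
  have [measurable]: "grid_cell n k \<in> sets borel" for k
    by (simp add: grid_cell_def)
  let ?A = "\<lambda>k. {\<omega> \<in> space M. U \<omega> \<le> t * grid_ceiling n (V \<omega>) \<and> V \<omega> \<in> grid_cell n k}"
  have "emeasure M {\<omega> \<in> space M. U \<omega> \<le> t * grid_ceiling n (V \<omega>)} = emeasure M (\<Union>k. ?A k)"
  proof (rule emeasure_eq_AE)
    show "AE \<omega> in M. \<omega> \<in> {\<omega> \<in> space M. U \<omega> \<le> t * grid_ceiling n (V \<omega>)} \<longleftrightarrow> \<omega> \<in> (\<Union>k. ?A k)"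
      using V
    proof eventually_elim
      case (elim \<omega>)
      then have "V \<omega> \<in> (\<Union>k. grid_cell n k)" by (simp add: UN_grid_cell)
      then show ?case by auto
    qed
  qed measurable
  also have "\<dots> = (\<Sum>k. emeasure M (?A k))"
    using disjoint_family_grid_cell[of n]
    by (intro suminf_emeasure[symmetric]) (auto simp: disjoint_family_on_def)
  \<comment> \<open>Reading the strip integrals as values of the single measure
    \<open>density lborel f\<close> allows them to be summed over the disjoint cells.\<close>
  also have "\<dots> = (\<Sum>k. emeasure (density lborel f) (grid_cell n k))"
  proof (rule suminf_cong)
    fix k
    let ?v = "real (Suc k) / real (Suc n)"
    have v: "0 < ?v" "real k / real (Suc n) < ?v" "0 \<le> real k / real (Suc n)"
      by (simp_all add: divide_strict_right_mono)
    have "?A k = {\<omega> \<in> space M. U \<omega> \<le> t * ?v \<and> V \<omega> \<in> grid_cell n k}"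
      by (auto simp: grid_ceiling_cell simp del: of_nat_Suc)
    also have "emeasure M \<dots> = (\<integral>\<^sup>+v\<in>grid_cell n k. ennreal (std_frechet_dcdf \<rho> (t * ?v) v) \<partial>lborel)"
      unfolding grid_cell_def
      by (rule std_frechet_strip[OF assms(1,2) V UV \<rho>(2) mult_pos_pos[OF t v(1)] v(3,2)])
    also have "\<dots> = (\<integral>\<^sup>+v\<in>grid_cell n k. f v \<partial>lborel)"
      by (intro nn_integral_cong) (auto simp: f_def indicator_def grid_ceiling_cell simp del: of_nat_Suc)
    finally show "emeasure M (?A k) = emeasure (density lborel f) (grid_cell n k)"
      by (simp add: emeasure_density)
  qed
  also have "\<dots> = emeasure (density lborel f) {0<..}"
    unfolding UN_grid_cell[of n, symmetric]
    by (intro suminf_emeasure disjoint_family_grid_cell) auto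
  also have "\<dots> = (\<integral>\<^sup>+v. ennreal (indicator {0<..} v *\<^sub>R std_frechet_dcdf \<rho> (t * grid_ceiling n v) v) \<partial>lborel)"
    by (subst emeasure_density) (auto intro!: nn_integral_cong simp: f_def indicator_def)
  finally have *: "emeasure M {\<omega> \<in> space M. U \<omega> \<le> t * grid_ceiling n (V \<omega>)} = \<dots>" .
  \<comment> \<open>A positive first argument makes the integrand nonnegative, as the passage from
    the nonnegative to the Lebesgue integral requires.\<close>
  have pos: "0 < t * grid_ceiling n v" if "0 < v" for v
    using that t grid_ceiling_ge[of v n] by (intro mult_pos_pos) linarith+
  show ?thesis
    unfolding set_lebesgue_integral_def measure_def *
    by (rule integral_eq_nn_integral[symmetric])
      (auto simp: indicator_def \<rho> pos intro!: std_frechet_dcdf_nonneg)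
qed

lemma (in prob_space) std_frechet_below_ray:
  assumes [measurable]: "random_variable borel U" "random_variable borel V"
    and V: "AE \<omega> in M. 0 < V \<omega>"
    and UV: "\<And>u v. 0 < u \<Longrightarrow> 0 < v \<Longrightarrow>
        prob {\<omega> \<in> space M. U \<omega> \<le> u \<and> V \<omega> \<le> v} = std_frechet_cdf \<rho> u v"
    and \<rho>: "0 \<le> \<rho>" "\<rho> \<le> 1" and t: "0 < t"
  shows "prob {\<omega> \<in> space M. U \<omega> \<le> t * V \<omega>}
    = t / (t + 1) * (((t + 1)\<^sup>2 - \<rho>) / ((t + 1)\<^sup>2 - \<rho> * t))"
proof -
  have pos: "0 < t * grid_ceiling n v" if "0 < v" for v n
    using that t grid_ceiling_ge[of v n] by (intro mult_pos_pos) linarith+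
  let ?I = "\<lambda>n \<omega>. indicator {\<omega> \<in> space M. U \<omega> \<le> t * grid_ceiling n (V \<omega>)} \<omega> :: real"
  have "(\<lambda>n. \<integral>\<omega>. ?I n \<omega> \<partial>M) \<longlonglongrightarrow> (\<integral>\<omega>. indicator {\<omega> \<in> space M. U \<omega> \<le> t * V \<omega>} \<omega> \<partial>M)"
  proof (rule integral_dominated_convergence[where w = "\<lambda>_. 1"])
    show "AE \<omega> in M. (\<lambda>n. ?I n \<omega>) \<longlonglongrightarrow> indicator {\<omega> \<in> space M. U \<omega> \<le> t * V \<omega>} \<omega>"
    proof (rule AE_I2, rule tendsto_eventually)
      fix \<omega> assume "\<omega> \<in> space M"
      show "\<forall>\<^sub>F n in sequentially. ?I n \<omega> = indicator {\<omega> \<in> space M. U \<omega> \<le> t * V \<omega>} \<omega>"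
      proof (cases "U \<omega> \<le> t * V \<omega>")
        \<comment> \<open>Rounding upwards makes the indicators converge also where \<open>U = t V\<close>,
          so no continuity of the law of \<open>U / V\<close> is needed.\<close>
        case True
        have "U \<omega> \<le> t * grid_ceiling n (V \<omega>)" for n
          using mult_left_mono[OF grid_ceiling_ge[of "V \<omega>" n], of t] t True by linarith
        then show ?thesis using True by (simp add: indicator_def)
      next
        case False
        \<comment> \<open>Here \<open>U\<close> strictly exceeds \<open>t V\<close>, so the rounded
          bound falls below \<open>U\<close> once the grid is fine enough.\<close>
        have "(\<lambda>n. t * grid_ceiling n (V \<omega>)) \<longlonglongrightarrow> t * V \<omega>"
          by (intro tendsto_intros grid_ceiling_tendsto)
        then have "\<forall>\<^sub>F n in sequentially. t * grid_ceiling n (V \<omega>) < U \<omega>"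
          using False by (intro order_tendstoD(2)) auto
        then show ?thesis
          by eventually_elim (use False in \<open>auto simp: indicator_def\<close>)
      qed
    qed
  qed auto
  then have lim1: "(\<lambda>n. prob {\<omega> \<in> space M. U \<omega> \<le> t * grid_ceiling n (V \<omega>)})
      \<longlonglongrightarrow> prob {\<omega> \<in> space M. U \<omega> \<le> t * V \<omega>}"
    by (simp add: Int_def conj_commute cong: conj_cong)
  \<comment> \<open>The integrands converge by continuity in the first argument, and the density of
    the second margin dominates them.\<close>
  have lim2: "(\<lambda>n. LBINT v:{0<..}. std_frechet_dcdf \<rho> (t * grid_ceiling n v) v)
      \<longlonglongrightarrow> (LBINT v:{0<..}. std_frechet_dcdf \<rho> (t * v) v)"
    unfolding set_lebesgue_integral_def
  proof (rule integral_dominated_convergence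
      [where w = "\<lambda>v. indicator {0<..} v *\<^sub>R (exp (- 1 / v) / v\<^sup>2)"])
    show "integrable lborel (\<lambda>v::real. indicator {0<..} v *\<^sub>R (exp (- 1 / v) / v\<^sup>2))"
      by (rule LBINT_exp_neg_inverse(1)[OF zero_less_one, unfolded set_integrable_def])
    show "AE v in lborel. (\<lambda>n. indicator {0<..} v *\<^sub>R std_frechet_dcdf \<rho> (t * grid_ceiling n v) v)
        \<longlonglongrightarrow> indicator {0<..} v *\<^sub>R std_frechet_dcdf \<rho> (t * v) v"
    proof (rule AE_I2)
      fix v :: real
      show "(\<lambda>n. indicator {0<..} v *\<^sub>R std_frechet_dcdf \<rho> (t * grid_ceiling n v) v)
        \<longlonglongrightarrow> indicator {0<..} v *\<^sub>R std_frechet_dcdf \<rho> (t * v) v"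
      proof (cases "0 < v")
        case True
        have "(\<lambda>n. std_frechet_dcdf \<rho> (t * grid_ceiling n v) v) \<longlonglongrightarrow> std_frechet_dcdf \<rho> (t * v) v"
          using t True by (intro isCont_tendsto_compose[OF isCont_std_frechet_dcdf(2)]
              tendsto_intros grid_ceiling_tendsto) auto
        then show ?thesis by (intro tendsto_intros)
      qed simp
    qed
    show "AE v in lborel. norm (indicator {0<..} v *\<^sub>R std_frechet_dcdf \<rho> (t * grid_ceiling n v) v)
        \<le> indicator {0<..} v *\<^sub>R (exp (- 1 / v) / v\<^sup>2)" for n
      using std_frechet_dcdf_nonneg[OF \<rho>(2) pos] std_frechet_dcdf_le[OF \<rho> pos]
      by (intro AE_I2) (auto simp: indicator_def)
  qed measurable
  have "prob {\<omega> \<in> space M. U \<omega> \<le> t * V \<omega>} = (LBINT v:{0<..}. std_frechet_dcdf \<rho> (t * v) v)"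
  proof (rule LIMSEQ_unique[OF lim1])
    show "(\<lambda>n. prob {\<omega> \<in> space M. U \<omega> \<le> t * grid_ceiling n (V \<omega>)})
      \<longlonglongrightarrow> (LBINT v:{0<..}. std_frechet_dcdf \<rho> (t * v) v)"
      by (rule Lim_transform_eventually[OF lim2], rule always_eventually, rule allI, rule sym,
          rule std_frechet_below_grid_ray[OF assms(1,2) V UV \<rho> t])
  qed
  then show ?thesis
    by (simp add: LBINT_std_frechet_dcdf_ray \<rho> t)
qed

section \<open>Almost sure positivity and normalisation of the given vector\<close>

text \<open>The event \<open>X \<le> 0\<close> is the countable union of the null boxes with
  \<open>y = real n\<close>.\<close>

lemma (in prob_space) AE_pos_if_lower_box_null:
  fixes X Y :: "'a \<Rightarrow> real"
  assumes [measurable]: "random_variable borel X" "random_variable borel Y"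
    and null: "\<And>y. prob {\<omega> \<in> space M. X \<omega> \<le> 0 \<and> Y \<omega> \<le> y} = 0"
  shows "AE \<omega> in M. 0 < X \<omega>"
proof -
  have "AE \<omega> in M. \<not> (X \<omega> \<le> 0 \<and> Y \<omega> \<le> real n)" for n
    using null[of "real n"] by (subst AE_iff_measurable[OF _ refl]) (auto simp: emeasure_eq_measure)
  then have "AE \<omega> in M. \<forall>n. \<not> (X \<omega> \<le> 0 \<and> Y \<omega> \<le> real n)"
    unfolding AE_all_countable by blast
  then show ?thesis
    by eventually_elim (metis linorder_not_le real_arch_simple)
qed

text \<open>The CDF vanishes already when one argument equals 0, which rules out mass on the axes.
  Almost surely the ratio then has a positive denominator and all powers have positive
  bases.\<close>

lemma bivariate_extreme_frechet_AE_pos: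
  assumes "bivariate_extreme_frechet M X1 X2 \<sigma>1 \<sigma>2 \<alpha> \<rho>"
  shows "AE \<omega> in M. 0 < X1 \<omega> \<and> 0 < X2 \<omega>"
proof -
  interpret prob_space M
    using assms by (simp add: bivariate_extreme_frechet_def)
  have [measurable]: "X1 \<in> borel_measurable M" "X2 \<in> borel_measurable M"
    and cdf: "\<And>x1 x2. measure M {\<omega> \<in> space M. X1 \<omega> \<le> x1 \<and> X2 \<omega> \<le> x2}
              = bivariate_frechet_cdf \<sigma>1 \<sigma>2 \<alpha> \<rho> x1 x2"
    using assms by (auto simp: bivariate_extreme_frechet_def)
  have "AE \<omega> in M. 0 < X1 \<omega>"
    by (rule AE_pos_if_lower_box_null[of X1 X2]) (auto simp: cdf bivariate_frechet_cdf_def)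
  moreover have "AE \<omega> in M. 0 < X2 \<omega>"
    using cdf by (intro AE_pos_if_lower_box_null[of X2 X1])
      (auto simp: bivariate_frechet_cdf_def conj_commute)
  ultimately show ?thesis by eventually_elim simp
qed

text \<open>Almost surely \<open>X1 / (X1 + X2) \<le> w\<close>, \<open>X1 \<le> s * X2\<close> and
  \<open>U \<le> t * V\<close> are equivalent, which reduces the claim to the standardised
  pair.\<close>

lemma bivariate_extreme_frechet_ratio:
  assumes \<sigma>: "\<sigma>1 > 0" "\<sigma>2 > 0" and \<alpha>: "\<alpha> > 0" and \<rho>: "0 \<le> \<rho>" "\<rho> \<le> 1"
    and X: "bivariate_extreme_frechet M X1 X2 \<sigma>1 \<sigma>2 \<alpha> \<rho>"
    and w: "0 < w" "w < 1"
  shows "measure M {\<omega> \<in> space M. X1 \<omega> / (X1 \<omega> + X2 \<omega>) \<le> w}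
    = unit_frechet_cdf (\<sigma>1 / \<sigma>2) \<alpha> \<rho> w"
proof -
  interpret prob_space M
    using X by (simp add: bivariate_extreme_frechet_def)
  have [measurable]: "X1 \<in> borel_measurable M" "X2 \<in> borel_measurable M"
    and cdf: "\<And>x1 x2. prob {\<omega> \<in> space M. X1 \<omega> \<le> x1 \<and> X2 \<omega> \<le> x2}
              = bivariate_frechet_cdf \<sigma>1 \<sigma>2 \<alpha> \<rho> x1 x2"
    using X by (auto simp: bivariate_extreme_frechet_def)
  note pos = bivariate_extreme_frechet_AE_pos[OF X]
  define U where "U \<omega> = (X1 \<omega> / \<sigma>1) powr \<alpha>" for \<omega>
  define V where "V \<omega> = (X2 \<omega> / \<sigma>2) powr \<alpha>" for \<omega>
  define s where "s = w / (1 - w)"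
  define t where "t = s powr \<alpha> / (\<sigma>1 / \<sigma>2) powr \<alpha>"
  have s: "0 < s" using w by (simp add: s_def)
  have t: "0 < t" using s \<sigma> by (simp add: t_def)
  \<comment> \<open>Inverts the normalisation on the positive axis, where the power is strictly
    increasing.\<close>
  have powr_le: "(x / \<sigma>') powr \<alpha> \<le> u \<longleftrightarrow> x \<le> \<sigma>' * u powr (1 / \<alpha>)"
    if "0 < x" "0 < \<sigma>'" "0 < u" for x \<sigma>' u :: real
  proof -
    have "(x / \<sigma>') powr \<alpha> \<le> u \<longleftrightarrow> (x / \<sigma>') powr \<alpha> \<le> (u powr (1 / \<alpha>)) powr \<alpha>"
      using that \<alpha> by (simp add: powr_powr)
    also have "\<dots> \<longleftrightarrow> x / \<sigma>' \<le> u powr (1 / \<alpha>)"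
      using that \<alpha> by (meson divide_pos_pos less_imp_le linorder_not_le powr_ge_zero
          powr_less_mono2 powr_mono2)
    finally show ?thesis
      using that by (simp add: field_simps)
  qed
  have UV: "prob {\<omega> \<in> space M. U \<omega> \<le> u \<and> V \<omega> \<le> v} = std_frechet_cdf \<rho> u v"
    if uv: "0 < u" "0 < v" for u v
  proof -
    have "prob {\<omega> \<in> space M. U \<omega> \<le> u \<and> V \<omega> \<le> v}
        = prob {\<omega> \<in> space M. X1 \<omega> \<le> \<sigma>1 * u powr (1 / \<alpha>) \<and> X2 \<omega> \<le> \<sigma>2 * v powr (1 / \<alpha>)}"
    proof (rule measure_eq_AE)
      show "AE \<omega> in M. \<omega> \<in> {\<omega> \<in> space M. U \<omega> \<le> u \<and> V \<omega> \<le> v} \<longleftrightarrow>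
        \<omega> \<in> {\<omega> \<in> space M. X1 \<omega> \<le> \<sigma>1 * u powr (1 / \<alpha>) \<and> X2 \<omega> \<le> \<sigma>2 * v powr (1 / \<alpha>)}"
        using pos by eventually_elim (use \<sigma> uv in \<open>auto simp: U_def V_def powr_le\<close>)
    qed (auto simp: U_def V_def)
    \<comment> \<open>At these arguments the scaled powers are exactly \<open>u\<close> and
      \<open>v\<close>, so every parameter except \<open>\<rho>\<close> drops out.\<close>
    also have "\<dots> = std_frechet_cdf \<rho> u v"
      unfolding cdf bivariate_frechet_cdf_def std_frechet_cdf_def
      using uv \<sigma> \<alpha> by (simp add: powr_powr powr_minus_divide inverse_eq_divide not_le)
    finally show ?thesis .
  qed
  have "prob {\<omega> \<in> space M. X1 \<omega> / (X1 \<omega> + X2 \<omega>) \<le> w} = prob {\<omega> \<in> space M. U \<omega> \<le> t * V \<omega>}"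
  proof (rule measure_eq_AE)
    show "AE \<omega> in M. \<omega> \<in> {\<omega> \<in> space M. X1 \<omega> / (X1 \<omega> + X2 \<omega>) \<le> w} \<longleftrightarrow>
        \<omega> \<in> {\<omega> \<in> space M. U \<omega> \<le> t * V \<omega>}"
      using pos
    proof eventually_elim
      case (elim \<omega>)
      then have x: "0 < X1 \<omega>" "0 < X2 \<omega>" by auto
      have "X1 \<omega> / (X1 \<omega> + X2 \<omega>) \<le> w \<longleftrightarrow> X1 \<omega> \<le> s * X2 \<omega>"
        using x w by (simp add: s_def field_simps)
      \<comment> \<open>The scale \<open>\<sigma>2\<close> cancels between \<open>t\<close> and
        \<open>V\<close>.\<close>
      moreover have "t * V \<omega> = ((s * X2 \<omega>) / \<sigma>1) powr \<alpha>"
        using x s \<sigma> by (simp add: t_def V_def powr_mult powr_divide)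
      then have "U \<omega> \<le> t * V \<omega> \<longleftrightarrow> X1 \<omega> \<le> s * X2 \<omega>"
        using x s \<sigma> \<alpha> by (simp add: U_def powr_le powr_powr)
      ultimately show ?case by simp
    qed
  qed (auto simp: U_def V_def)
  also have "\<dots> = t / (t + 1) * (((t + 1)\<^sup>2 - \<rho>) / ((t + 1)\<^sup>2 - \<rho> * t))"
  proof (rule std_frechet_below_ray[OF _ _ _ UV \<rho> t])
    show "AE \<omega> in M. 0 < V \<omega>"
      using pos by eventually_elim (use \<sigma> in \<open>simp add: V_def\<close>)
  qed (auto simp: U_def V_def)
  finally show ?thesis
    by (simp add: unit_frechet_cdf_def Let_def t_def s_def)
qed

section \<open>Equality in distribution\<close>

text \<open>The explicit CDF covers only \<open>0 < w < 1\<close>; concentration on the open unit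
  interval fixes the remaining values.\<close>

lemma cdf_distr_01_outside:
  assumes "prob_space M" and [measurable]: "f \<in> borel_measurable M"
    and f: "AE \<omega> in M. 0 < f \<omega> \<and> f \<omega> < (1::real)"
  shows "w \<le> 0 \<Longrightarrow> cdf (distr M borel f) w = 0" "1 \<le> w \<Longrightarrow> cdf (distr M borel f) w = 1"
proof -
  interpret prob_space M by fact
  have eq: "cdf (distr M borel f) w = prob {\<omega> \<in> space M. f \<omega> \<le> w}"
    by (simp add: cdf_def measure_distr vimage_def Int_def conj_commute)
  show "cdf (distr M borel f) w = 0" if "w \<le> 0"
  proof -
    have "prob {\<omega> \<in> space M. f \<omega> \<le> w} = prob {}"
      using f that by (intro measure_eq_AE) auto
    then show ?thesis by (simp add: eq)
  qed
  show "cdf (distr M borel f) w = 1" if "1 \<le> w"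
  proof -
    have "prob {\<omega> \<in> space M. f \<omega> \<le> w} = prob (space M)"
      using f that by (intro measure_eq_AE) auto
    then show ?thesis by (simp add: eq prob_space)
  qed
qed

theorem mainTheorem3:
  fixes M :: "'a measure" and X1 X2 :: "'a \<Rightarrow> real"
    and \<sigma>1 \<sigma>2 \<sigma> \<alpha> \<rho> :: real
  assumes "\<sigma>1 > 0" and "\<sigma>2 > 0" and "\<alpha> > 0" and "0 \<le> \<rho>" and "\<rho> \<le> 1"
    and "bivariate_extreme_frechet M X1 X2 \<sigma>1 \<sigma>2 \<alpha> \<rho>"
    and "\<sigma> = \<sigma>1 / \<sigma>2"
  shows "(\<forall>w s. 0 < w \<and> w < 1 \<and> s = w / (1 - w) \<longrightarrow>
            measure M {\<omega> \<in> space M. X1 \<omega> / (X1 \<omega> + X2 \<omega>) \<le> w}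
              = (s powr \<alpha> / \<sigma> powr \<alpha>) / (s powr \<alpha> / \<sigma> powr \<alpha> + 1)
                * (((s powr \<alpha> / \<sigma> powr \<alpha> + 1)\<^sup>2 - \<rho>)
                   / ((s powr \<alpha> / \<sigma> powr \<alpha> + 1)\<^sup>2 - \<rho> * (s powr \<alpha> / \<sigma> powr \<alpha>)))
            \<and> measure M {\<omega> \<in> space M. X1 \<omega> / (X1 \<omega> + X2 \<omega>) \<le> w}
              = unit_frechet_cdf \<sigma> \<alpha> \<rho> w)
       \<and> (\<forall>(N :: 'b measure) W. unit_frechet N W \<sigma> \<alpha> \<rho> \<longrightarrow>
            distr N borel W = distr M borel (\<lambda>\<omega>. X1 \<omega> / (X1 \<omega> + X2 \<omega>)))"
proof -
  let ?R = "\<lambda>\<omega>. X1 \<omega> / (X1 \<omega> + X2 \<omega>)"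
  have ratio: "measure M {\<omega> \<in> space M. ?R \<omega> \<le> w} = unit_frechet_cdf \<sigma> \<alpha> \<rho> w"
    if "0 < w" "w < 1" for w
    using bivariate_extreme_frechet_ratio[OF assms(1-6) that] assms(7) by simp
  have M: "prob_space M" and [measurable]: "X1 \<in> borel_measurable M" "X2 \<in> borel_measurable M"
    using assms(6) by (auto simp: bivariate_extreme_frechet_def)
  have R01: "AE \<omega> in M. 0 < ?R \<omega> \<and> ?R \<omega> < 1"
    using bivariate_extreme_frechet_AE_pos[OF assms(6)] by eventually_elim auto
  have "distr N borel W = distr M borel ?R" if "unit_frechet N W \<sigma> \<alpha> \<rho>"
    for N :: "'b measure" and W
  proof -
    have N: "prob_space N" and W [measurable]: "W \<in> borel_measurable N"
      and W01: "AE \<omega> in N. 0 < W \<omega> \<and> W \<omega> < 1"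
      and cdfW: "\<And>w. 0 < w \<Longrightarrow> w < 1 \<Longrightarrow> cdf (distr N borel W) w = unit_frechet_cdf \<sigma> \<alpha> \<rho> w"
      using that by (auto simp: unit_frechet_def)
    have "cdf (distr N borel W) w = cdf (distr M borel ?R) w" for w
    proof -
      \<comment> \<open>The explicit formula settles the middle case, concentration on the open unit
        interval the two outer ones; together they give the equality of CDFs that determines the
        law.\<close>
      consider "w \<le> 0" | "0 < w" "w < 1" | "1 \<le> w" by linarith
      then show ?thesis
      proof cases
        case 2
        have "cdf (distr M borel ?R) w = measure M {\<omega> \<in> space M. ?R \<omega> \<le> w}"
          by (simp add: cdf_def measure_distr vimage_def Int_def conj_commute)
        then show ?thesis using 2 by (simp add: cdfW ratio)
      qed (simp_all add: cdf_distr_01_outside[OF N W W01] cdf_distr_01_outside[OF M _ R01])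
    qed
    then show ?thesis
      using prob_space.real_distribution_distr[OF N] prob_space.real_distribution_distr[OF M]
      by (intro cdf_unique) auto
  qed
  then show ?thesis
    using ratio by (auto simp: unit_frechet_cdf_def Let_def)
qed

end
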